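(* Let $V$ be a $\mathbf{k}$-module, let $[\ ,\ ]_1$ and $[\ ,\ ]_2$ be binary operations on $V$ and let $P:V\to V$ be a linear map such that (1) $[\ ,\ ]_1$ and $[\ ,\ ]_2$ are Lie brackets; (2) $[[x,y]_1,z]_2+[[z,x]_2,y]_1+[[y,z]_1,x]_2=0$ for all $x,y,z\in V$; (3) $[P(x),P(y)]_1=P([P(x),y]_1)+P([x,P(y)]_1)+P([x,y]_2)$ for all $x,y\in V$. Then the operations $$x\circ y:=[P(x),y]_1,\qquad [x,y]:=[x,y]_2,\qquad \forall x,y\in V,$$ define a PostLie algebra $(V,\circ,[\ ,\ ])$. In particular, if $(V,[\ ,\ ]_1,[\ ,\ ]_2)$ is a totally compatible Lie dialgebra and $P:V\to V$ is a linear map satisfying $[P(x),P(y)]_1=P([P(x),y]_1)+P([x,P(y)]_1)+P([x,y]_2)$ for all $x,y\in V$, then the operations $x\circ y:=[P(x),y]_1$ and $[x,y]:=[x,y]_2$, for all $x,y\in V$, define a PostLie algebra $(V,\circ,[\ ,\ ])$.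
   Context: $\mathbf{k}$ is a commutative unitary ring. A totally compatible Lie dialgebra is a triple $(V,[\ ,\ ]_1,[\ ,\ ]_2)$ where $[\ ,\ ]_1$ and $[\ ,\ ]_2$ are Lie brackets on the $\mathbf{k}$-module $V$ such that for all $x,y,z\in V$: $[[x,y]_1,z]_2=[[x,y]_2,z]_1$ and $[[x,y]_1,z]_2+[[z,x]_1,y]_2+[[y,z]_1,x]_2=0$. A PostLie algebra is a $\mathbf{k}$-module $L$ with two bilinear operations $\circ$ and $[\ ,\ ]$ such that for all $x,y,z\in L$: $[x,y]=-[y,x]$; $[[x,y],z]+[[z,x],y]+[[y,z],x]=0$; $x\circ(y\circ z)-y\circ(x\circ z)+(y\circ x)\circ z-(x\circ y)\circ z+[y,x]\circ z=0$; $z\circ[x,y]-[z\circ x,y]-[x,z\circ y]=0$. *)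

theory Defs
  imports "HOL-Algebra.Module"
begin

definition linear_endo :: "('k, 'r) ring_scheme \<Rightarrow> ('k, 'v, 'm) module_scheme \<Rightarrow> ('v \<Rightarrow> 'v) \<Rightarrow> bool"
  where "linear_endo R V f \<longleftrightarrow>
    f \<in> carrier V \<rightarrow> carrier V \<and>
    (\<forall>x\<in>carrier V. \<forall>y\<in>carrier V. f (x \<oplus>\<^bsub>V\<^esub> y) = f x \<oplus>\<^bsub>V\<^esub> f y) \<and>
    (\<forall>a\<in>carrier R. \<forall>x\<in>carrier V. f (a \<odot>\<^bsub>V\<^esub> x) = a \<odot>\<^bsub>V\<^esub> f x)"

definition bilinear_op :: "('k, 'r) ring_scheme \<Rightarrow> ('k, 'v, 'm) module_scheme \<Rightarrow> ('v \<Rightarrow> 'v \<Rightarrow> 'v) \<Rightarrow> bool"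
  where "bilinear_op R V m \<longleftrightarrow>
    (\<forall>x\<in>carrier V. linear_endo R V (\<lambda>y. m x y)) \<and>
    (\<forall>y\<in>carrier V. linear_endo R V (\<lambda>x. m x y))"

text \<open>Over an arbitrary commutative ring, the antisymmetry required of the bracket of a PostLie
  algebra is weaker than the alternating law \<open>br x x = 0\<close>. The same antisymmetry is used for
  Lie brackets here. The lemma \<open>lie_bracket_if_alternating\<close> below shows that brackets that are
  alternating in the strict sense are included.\<close>

definition lie_bracket :: "('k, 'r) ring_scheme \<Rightarrow> ('k, 'v, 'm) module_scheme \<Rightarrow> ('v \<Rightarrow> 'v \<Rightarrow> 'v) \<Rightarrow> bool"
  where "lie_bracket R V br \<longleftrightarrow>
    module R V \<and> bilinear_op R V br \<and>
    (\<forall>x\<in>carrier V. \<forall>y\<in>carrier V. br x y = \<ominus>\<^bsub>V\<^esub> br y x) \<and>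
    (\<forall>x\<in>carrier V. \<forall>y\<in>carrier V. \<forall>z\<in>carrier V.
      br (br x y) z \<oplus>\<^bsub>V\<^esub> br (br z x) y \<oplus>\<^bsub>V\<^esub> br (br y z) x = \<zero>\<^bsub>V\<^esub>)"

definition totally_compatible_lie_dialgebra ::
    "('k, 'r) ring_scheme \<Rightarrow> ('k, 'v, 'm) module_scheme \<Rightarrow> ('v \<Rightarrow> 'v \<Rightarrow> 'v) \<Rightarrow> ('v \<Rightarrow> 'v \<Rightarrow> 'v) \<Rightarrow> bool"
  where "totally_compatible_lie_dialgebra R V br1 br2 \<longleftrightarrow>
    lie_bracket R V br1 \<and> lie_bracket R V br2 \<and>
    (\<forall>x\<in>carrier V. \<forall>y\<in>carrier V. \<forall>z\<in>carrier V. br2 (br1 x y) z = br1 (br2 x y) z) \<and>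
    (\<forall>x\<in>carrier V. \<forall>y\<in>carrier V. \<forall>z\<in>carrier V.
      br2 (br1 x y) z \<oplus>\<^bsub>V\<^esub> br2 (br1 z x) y \<oplus>\<^bsub>V\<^esub> br2 (br1 y z) x = \<zero>\<^bsub>V\<^esub>)"

definition postlie_algebra ::
    "('k, 'r) ring_scheme \<Rightarrow> ('k, 'v, 'm) module_scheme \<Rightarrow> ('v \<Rightarrow> 'v \<Rightarrow> 'v) \<Rightarrow> ('v \<Rightarrow> 'v \<Rightarrow> 'v) \<Rightarrow> bool"
  where "postlie_algebra R L circ br \<longleftrightarrow>
    module R L \<and> bilinear_op R L circ \<and> bilinear_op R L br \<and>
    (\<forall>x\<in>carrier L. \<forall>y\<in>carrier L. br x y = \<ominus>\<^bsub>L\<^esub> br y x) \<and>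
    (\<forall>x\<in>carrier L. \<forall>y\<in>carrier L. \<forall>z\<in>carrier L.
      br (br x y) z \<oplus>\<^bsub>L\<^esub> br (br z x) y \<oplus>\<^bsub>L\<^esub> br (br y z) x = \<zero>\<^bsub>L\<^esub>) \<and>
    (\<forall>x\<in>carrier L. \<forall>y\<in>carrier L. \<forall>z\<in>carrier L.
      circ x (circ y z) \<ominus>\<^bsub>L\<^esub> circ y (circ x z) \<oplus>\<^bsub>L\<^esub> circ (circ y x) z
        \<ominus>\<^bsub>L\<^esub> circ (circ x y) z \<oplus>\<^bsub>L\<^esub> circ (br y x) z = \<zero>\<^bsub>L\<^esub>) \<and>
    (\<forall>x\<in>carrier L. \<forall>y\<in>carrier L. \<forall>z\<in>carrier L.
      circ z (br x y) \<ominus>\<^bsub>L\<^esub> br (circ z x) y \<ominus>\<^bsub>L\<^esub> br x (circ z y) = \<zero>\<^bsub>L\<^esub>)"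

lemma lie_bracket_if_alternating:
  assumes V: "module R V" and bil: "bilinear_op R V br"
    and alt: "\<And>x. x \<in> carrier V \<Longrightarrow> br x x = \<zero>\<^bsub>V\<^esub>"
    and jac: "\<And>x y z. \<lbrakk>x \<in> carrier V; y \<in> carrier V; z \<in> carrier V\<rbrakk> \<Longrightarrow>
      br (br x y) z \<oplus>\<^bsub>V\<^esub> br (br z x) y \<oplus>\<^bsub>V\<^esub> br (br y z) x = \<zero>\<^bsub>V\<^esub>"
  shows "lie_bracket R V br"
proof -
  interpret module R V by (rule V)
  have "br x y = \<ominus>\<^bsub>V\<^esub> br y x" if x: "x \<in> carrier V" and y: "y \<in> carrier V" for x y
  proof -
    have cl: "br u v \<in> carrier V" if "u \<in> carrier V" "v \<in> carrier V" for u v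
      using bil that by (auto simp: bilinear_op_def linear_endo_def)
    have l: "br (u \<oplus>\<^bsub>V\<^esub> v) w = br u w \<oplus>\<^bsub>V\<^esub> br v w"
      and r: "br w (u \<oplus>\<^bsub>V\<^esub> v) = br w u \<oplus>\<^bsub>V\<^esub> br w v"
      if "u \<in> carrier V" "v \<in> carrier V" "w \<in> carrier V" for u v w
      using bil that by (simp_all add: bilinear_op_def linear_endo_def)
    have "br (x \<oplus>\<^bsub>V\<^esub> y) (x \<oplus>\<^bsub>V\<^esub> y) = \<zero>\<^bsub>V\<^esub>"
      using x y by (intro alt) simp
    moreover have "br (x \<oplus>\<^bsub>V\<^esub> y) (x \<oplus>\<^bsub>V\<^esub> y) =
        (br x x \<oplus>\<^bsub>V\<^esub> br y x) \<oplus>\<^bsub>V\<^esub> (br x y \<oplus>\<^bsub>V\<^esub> br y y)"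
      using r[of x y "x \<oplus>\<^bsub>V\<^esub> y"] l[of x y x] l[of x y y] x y by simp
    ultimately have "br y x \<oplus>\<^bsub>V\<^esub> br x y = \<zero>\<^bsub>V\<^esub>"
      using alt[OF x] alt[OF y] cl[OF x y] cl[OF y x] by simp
    then have "br x y \<oplus>\<^bsub>V\<^esub> br y x = \<zero>\<^bsub>V\<^esub>"
      using M.a_comm[OF cl[OF x y] cl[OF y x]] by (rule trans[rotated])
    then show ?thesis
      using x y by (simp add: M.minus_equality cl)
  qed
  then show ?thesis
    using V bil jac unfolding lie_bracket_def by blast
qed

end

theory Submission
  imports Defs
begin

text \<open>Write \<open>D w\<close> for the left multiplication \<open>br1 w\<close>. Up to antisymmetry of both brackets, the
  mixed Jacobi identity says exactly that every \<open>D w\<close> is a derivation of \<open>br2\<close>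
  (\<open>mixed_jacobi_imp_derivation\<close>); taking \<open>w\<close> in the image of \<open>P\<close> gives the PostLie axiom
  that relates \<open>circ z\<close> to the bracket.
  The ordinary Jacobi identity is the mixed one for \<open>br2 = br1\<close>, so the same fact
  shows that \<open>D\<close> turns \<open>br1\<close> into the commutator of operators:
  \<open>D (P x) (D (P y) z) - D (P y) (D (P x) z) = br1 (br1 (P x) (P y)) z\<close>.
  Expanding \<open>br1 (P x) (P y)\<close> by the Rota-Baxter-like equation for \<open>P\<close> produces, up to swapping
  the arguments of antisymmetric brackets, the three terms that balance this commutator in the
  other PostLie axiom (\<open>rota_baxter_postlie_associator\<close>).

  In a totally compatible Lie dialgebra, the equality of the two mixed compositions turns the cyclic
  compatibility identity into the mixed Jacobi identity, which reduces the second claim to the first.\<close>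

lemma linear_endo_closed:
  "\<lbrakk>linear_endo R V f; x \<in> carrier V\<rbrakk> \<Longrightarrow> f x \<in> carrier V"
  by (auto simp: linear_endo_def)

lemma linear_endo_add:
  "\<lbrakk>linear_endo R V f; x \<in> carrier V; y \<in> carrier V\<rbrakk>
    \<Longrightarrow> f (x \<oplus>\<^bsub>V\<^esub> y) = f x \<oplus>\<^bsub>V\<^esub> f y"
  by (simp add: linear_endo_def)

lemma linear_endo_neg:
  assumes "module R V" "linear_endo R V f" "x \<in> carrier V"
  shows "f (\<ominus>\<^bsub>V\<^esub> x) = \<ominus>\<^bsub>V\<^esub> f x"
proof -
  interpret module R V by (rule assms(1))
  have "f \<in> carrier V \<rightarrow> carrier V"
    using assms(2) by (simp add: linear_endo_def)
  moreover have "\<ominus>\<^bsub>V\<^esub> y = (\<ominus>\<^bsub>R\<^esub> \<one>\<^bsub>R\<^esub>) \<odot>\<^bsub>V\<^esub> y" if "y \<in> carrier V" for y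
    using that by (simp add: smult_l_minus)
  ultimately show ?thesis
    using assms(2,3) by (auto simp: linear_endo_def Pi_iff)
qed

lemma linear_endo_compose:
  assumes "linear_endo R V f" "linear_endo R V g"
  shows "linear_endo R V (\<lambda>x. f (g x))"
  using assms by (auto simp: linear_endo_def Pi_iff)

lemma bilinear_op_left:
  "\<lbrakk>bilinear_op R V m; y \<in> carrier V\<rbrakk> \<Longrightarrow> linear_endo R V (\<lambda>x. m x y)"
  by (simp add: bilinear_op_def)

lemma bilinear_op_right:
  "\<lbrakk>bilinear_op R V m; x \<in> carrier V\<rbrakk> \<Longrightarrow> linear_endo R V (\<lambda>y. m x y)"
  by (simp add: bilinear_op_def)

lemma bilinear_op_closed:
  "\<lbrakk>bilinear_op R V m; x \<in> carrier V; y \<in> carrier V\<rbrakk> \<Longrightarrow> m x y \<in> carrier V"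
  by (rule linear_endo_closed[OF bilinear_op_right])

lemma bilinear_op_twist_left:
  assumes "bilinear_op R V m" "linear_endo R V f"
  shows "bilinear_op R V (\<lambda>x y. m (f x) y)"
  using assms linear_endo_compose[OF bilinear_op_left[OF assms(1)] assms(2)]
  by (auto simp: bilinear_op_def intro: linear_endo_closed)

lemma lie_bracket_antisym:
  "\<lbrakk>lie_bracket R V br; x \<in> carrier V; y \<in> carrier V\<rbrakk> \<Longrightarrow> br x y = \<ominus>\<^bsub>V\<^esub> br y x"
  unfolding lie_bracket_def by blast

text \<open>Instantiate the mixed Jacobi identity at \<open>(y, w, x)\<close>: its middle term is the negative of the left-hand
  side, and antisymmetry, used once inside and once outside, identifies its first term with the second
  summand on the right. The case \<open>br2 = br1\<close> is the Leibniz form of the Jacobi identity.\<close>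

lemma mixed_jacobi_imp_derivation:
  assumes L1: "lie_bracket R V br1" and L2: "lie_bracket R V br2"
    and mixed: "\<And>x y z. \<lbrakk>x \<in> carrier V; y \<in> carrier V; z \<in> carrier V\<rbrakk> \<Longrightarrow>
      br2 (br1 x y) z \<oplus>\<^bsub>V\<^esub> br1 (br2 z x) y \<oplus>\<^bsub>V\<^esub> br2 (br1 y z) x = \<zero>\<^bsub>V\<^esub>"
    and w: "w \<in> carrier V" and x: "x \<in> carrier V" and y: "y \<in> carrier V"
  shows "br1 w (br2 x y) = br2 (br1 w x) y \<oplus>\<^bsub>V\<^esub> br2 x (br1 w y)"
proof -
  have V: "module R V" and b1: "bilinear_op R V br1" and b2: "bilinear_op R V br2"
    using L1 L2 by (auto simp: lie_bracket_def)
  interpret module R V by (rule V)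
  note cl = bilinear_op_closed[OF b1] bilinear_op_closed[OF b2]
  have "br2 x (br1 w y) = \<ominus>\<^bsub>V\<^esub> br2 (br1 w y) x"
    by (rule lie_bracket_antisym[OF L2]) (simp_all add: cl w x y)
  also have "\<dots> = br2 (\<ominus>\<^bsub>V\<^esub> br1 w y) x"
    by (rule linear_endo_neg[OF V bilinear_op_left[OF b2 x], symmetric]) (simp add: cl w y)
  also have "\<ominus>\<^bsub>V\<^esub> br1 w y = br1 y w"
    by (rule lie_bracket_antisym[OF L1 y w, symmetric])
  finally have swap: "br2 x (br1 w y) = br2 (br1 y w) x" .
  have "br2 (br1 w x) y \<oplus>\<^bsub>V\<^esub> br2 (br1 y w) x \<oplus>\<^bsub>V\<^esub> br1 (br2 x y) w = \<zero>\<^bsub>V\<^esub>"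
    using mixed[OF y w x] by (simp add: cl w x y M.a_ac)
  then have "br2 (br1 w x) y \<oplus>\<^bsub>V\<^esub> br2 (br1 y w) x = \<ominus>\<^bsub>V\<^esub> br1 (br2 x y) w"
    by (intro M.minus_equality[symmetric]) (simp_all add: cl w x y)
  also have "\<dots> = br1 w (br2 x y)"
    by (rule lie_bracket_antisym[OF L1, symmetric]) (simp_all add: cl w x y)
  finally show ?thesis
    by (simp add: swap)
qed

text \<open>By the Leibniz form of Jacobi, the commutator of the left multiplications by \<open>P x\<close> and \<open>P y\<close>
  is left multiplication by \<open>br1 (P x) (P y)\<close>, and the equation for \<open>P\<close> splits the latter into the
  summands that cancel the other three terms.\<close>

lemma rota_baxter_postlie_associator:
  assumes L1: "lie_bracket R V br1"
    and b2: "bilinear_op R V br2"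
    and anti2: "\<And>x y. \<lbrakk>x \<in> carrier V; y \<in> carrier V\<rbrakk> \<Longrightarrow> br2 x y = \<ominus>\<^bsub>V\<^esub> br2 y x"
    and P: "linear_endo R V P"
    and x: "x \<in> carrier V" and y: "y \<in> carrier V" and z: "z \<in> carrier V"
    and rb: "br1 (P x) (P y) = P (br1 (P x) y) \<oplus>\<^bsub>V\<^esub> P (br1 x (P y)) \<oplus>\<^bsub>V\<^esub> P (br2 x y)"
  shows "br1 (P x) (br1 (P y) z) \<ominus>\<^bsub>V\<^esub> br1 (P y) (br1 (P x) z) \<oplus>\<^bsub>V\<^esub> br1 (P (br1 (P y) x)) z
        \<ominus>\<^bsub>V\<^esub> br1 (P (br1 (P x) y)) z \<oplus>\<^bsub>V\<^esub> br1 (P (br2 y x)) z = \<zero>\<^bsub>V\<^esub>"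
proof -
  have V: "module R V" and b1: "bilinear_op R V br1"
    using L1 by (auto simp: lie_bracket_def)
  interpret module R V by (rule V)
  note cl = bilinear_op_closed[OF b1] bilinear_op_closed[OF b2] linear_endo_closed[OF P]
  note add = linear_endo_add[OF bilinear_op_left[OF b1 z]]
  have lin: "linear_endo R V (\<lambda>u. br1 (P u) z)"
    by (rule linear_endo_compose[OF bilinear_op_left[OF b1 z] P])
  define p where "p = br1 (P (br1 (P x) y)) z"
  define q where "q = br1 (P (br1 x (P y))) z"
  define r where "r = br1 (P (br2 x y)) z"
  define b where "b = br1 (P y) (br1 (P x) z)"
  have mem: "p \<in> carrier V" "q \<in> carrier V" "r \<in> carrier V" "b \<in> carrier V"
    by (simp_all add: p_def q_def r_def b_def cl x y z)
  have "br1 (P x) (br1 (P y) z) = br1 (br1 (P x) (P y)) z \<oplus>\<^bsub>V\<^esub> b"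
    unfolding b_def
  proof (rule mixed_jacobi_imp_derivation[OF L1 L1])
    show "br1 (br1 u v) w \<oplus>\<^bsub>V\<^esub> br1 (br1 w u) v \<oplus>\<^bsub>V\<^esub> br1 (br1 v w) u = \<zero>\<^bsub>V\<^esub>"
      if "u \<in> carrier V" "v \<in> carrier V" "w \<in> carrier V" for u v w
      using L1 that unfolding lie_bracket_def by blast
  qed (simp_all add: cl x y z)
  also have "br1 (br1 (P x) (P y)) z = p \<oplus>\<^bsub>V\<^esub> q \<oplus>\<^bsub>V\<^esub> r"
    by (simp add: rb p_def q_def r_def add cl x y z)
  finally have commutator: "br1 (P x) (br1 (P y) z) = p \<oplus>\<^bsub>V\<^esub> q \<oplus>\<^bsub>V\<^esub> r \<oplus>\<^bsub>V\<^esub> b" .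
  have nq: "br1 (P (br1 (P y) x)) z = \<ominus>\<^bsub>V\<^esub> q"
    unfolding q_def
    using linear_endo_neg[OF V lin, of "br1 x (P y)"] lie_bracket_antisym[OF L1, of "P y" x]
    by (simp add: cl x y)
  have nr: "br1 (P (br2 y x)) z = \<ominus>\<^bsub>V\<^esub> r"
    unfolding r_def
    using linear_endo_neg[OF V lin, of "br2 x y"] anti2[OF y x]
    by (simp add: cl x y)
  have "(p \<oplus>\<^bsub>V\<^esub> q \<oplus>\<^bsub>V\<^esub> r \<oplus>\<^bsub>V\<^esub> b) \<ominus>\<^bsub>V\<^esub> b \<oplus>\<^bsub>V\<^esub> \<ominus>\<^bsub>V\<^esub> q \<ominus>\<^bsub>V\<^esub> p \<oplus>\<^bsub>V\<^esub> \<ominus>\<^bsub>V\<^esub> r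
      = (p \<oplus>\<^bsub>V\<^esub> q \<oplus>\<^bsub>V\<^esub> r \<oplus>\<^bsub>V\<^esub> b) \<oplus>\<^bsub>V\<^esub> \<ominus>\<^bsub>V\<^esub> (p \<oplus>\<^bsub>V\<^esub> q \<oplus>\<^bsub>V\<^esub> r \<oplus>\<^bsub>V\<^esub> b)"
    using mem by (simp add: M.minus_eq M.minus_add M.a_ac)
  also have "\<dots> = \<zero>\<^bsub>V\<^esub>"
    by (rule M.r_neg) (simp add: mem)
  finally show ?thesis
    unfolding commutator nq nr p_def[symmetric] b_def[symmetric] .
qed

lemma mixed_jacobi_imp_postlie:
  assumes L1: "lie_bracket R V br1" and L2: "lie_bracket R V br2"
    and mixed: "\<And>x y z. \<lbrakk>x \<in> carrier V; y \<in> carrier V; z \<in> carrier V\<rbrakk> \<Longrightarrow>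
      br2 (br1 x y) z \<oplus>\<^bsub>V\<^esub> br1 (br2 z x) y \<oplus>\<^bsub>V\<^esub> br2 (br1 y z) x = \<zero>\<^bsub>V\<^esub>"
    and P: "linear_endo R V P"
    and rb: "\<And>x y. \<lbrakk>x \<in> carrier V; y \<in> carrier V\<rbrakk> \<Longrightarrow>
      br1 (P x) (P y) = P (br1 (P x) y) \<oplus>\<^bsub>V\<^esub> P (br1 x (P y)) \<oplus>\<^bsub>V\<^esub> P (br2 x y)"
  shows "postlie_algebra R V (\<lambda>x y. br1 (P x) y) br2"
proof -
  have V: "module R V" and b1: "bilinear_op R V br1" and b2: "bilinear_op R V br2"
    using L1 L2 by (auto simp: lie_bracket_def)
  interpret module R V by (rule V)
  have "br1 (P z) (br2 x y) \<ominus>\<^bsub>V\<^esub> br2 (br1 (P z) x) y \<ominus>\<^bsub>V\<^esub> br2 x (br1 (P z) y) = \<zero>\<^bsub>V\<^esub>"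
    if x: "x \<in> carrier V" and y: "y \<in> carrier V" and z: "z \<in> carrier V" for x y z
  proof -
    have Pz: "P z \<in> carrier V"
      by (rule linear_endo_closed[OF P z])
    have derivation: "br1 (P z) (br2 x y) = br2 (br1 (P z) x) y \<oplus>\<^bsub>V\<^esub> br2 x (br1 (P z) y)"
      by (rule mixed_jacobi_imp_derivation[OF L1 L2 _ Pz x y]) (rule mixed)
    have "br2 (br1 (P z) x) y \<in> carrier V" "br2 x (br1 (P z) y) \<in> carrier V"
      by (simp_all add: bilinear_op_closed[OF b1] bilinear_op_closed[OF b2] Pz x y)
    then show ?thesis
      by (simp add: derivation M.minus_eq M.a_ac M.r_neg1 M.r_neg)
  qed
  moreover have "br1 (P x) (br1 (P y) z) \<ominus>\<^bsub>V\<^esub> br1 (P y) (br1 (P x) z) \<oplus>\<^bsub>V\<^esub> br1 (P (br1 (P y) x)) z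
      \<ominus>\<^bsub>V\<^esub> br1 (P (br1 (P x) y)) z \<oplus>\<^bsub>V\<^esub> br1 (P (br2 y x)) z = \<zero>\<^bsub>V\<^esub>"
    if x: "x \<in> carrier V" and y: "y \<in> carrier V" and z: "z \<in> carrier V" for x y z
    using L1 b2 lie_bracket_antisym[OF L2] P x y z rb[OF x y]
    by (rule rota_baxter_postlie_associator)
  moreover have "bilinear_op R V (\<lambda>x y. br1 (P x) y)"
    by (rule bilinear_op_twist_left[OF b1 P])
  ultimately show ?thesis
    using L2 unfolding postlie_algebra_def lie_bracket_def by blast
qed

theorem theorem5p7:
  fixes R :: "('k, 'r) ring_scheme"
    and V :: "('k, 'v, 'm) module_scheme"
    and br1 br2 :: "'v \<Rightarrow> 'v \<Rightarrow> 'v"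
    and P :: "'v \<Rightarrow> 'v"
  assumes "module R V"
    and "linear_endo R V P"
    and "\<forall>x\<in>carrier V. \<forall>y\<in>carrier V.
      br1 (P x) (P y) = P (br1 (P x) y) \<oplus>\<^bsub>V\<^esub> P (br1 x (P y)) \<oplus>\<^bsub>V\<^esub> P (br2 x y)"
  shows "(lie_bracket R V br1 \<and> lie_bracket R V br2 \<and>
        (\<forall>x\<in>carrier V. \<forall>y\<in>carrier V. \<forall>z\<in>carrier V.
          br2 (br1 x y) z \<oplus>\<^bsub>V\<^esub> br1 (br2 z x) y \<oplus>\<^bsub>V\<^esub> br2 (br1 y z) x = \<zero>\<^bsub>V\<^esub>)
      \<longrightarrow> postlie_algebra R V (\<lambda>x y. br1 (P x) y) (\<lambda>x y. br2 x y))
    \<and> (totally_compatible_lie_dialgebra R V br1 br2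
      \<longrightarrow> postlie_algebra R V (\<lambda>x y. br1 (P x) y) (\<lambda>x y. br2 x y))"
proof (intro conjI impI)
  note P = assms(2) and rb = assms(3)[rule_format]
  {
    assume "lie_bracket R V br1 \<and> lie_bracket R V br2 \<and>
      (\<forall>x\<in>carrier V. \<forall>y\<in>carrier V. \<forall>z\<in>carrier V.
        br2 (br1 x y) z \<oplus>\<^bsub>V\<^esub> br1 (br2 z x) y \<oplus>\<^bsub>V\<^esub> br2 (br1 y z) x = \<zero>\<^bsub>V\<^esub>)"
    then show "postlie_algebra R V (\<lambda>x y. br1 (P x) y) (\<lambda>x y. br2 x y)"
      by (intro mixed_jacobi_imp_postlie P rb) auto
  next
    assume T: "totally_compatible_lie_dialgebra R V br1 br2"
    have "br2 (br1 x y) z \<oplus>\<^bsub>V\<^esub> br1 (br2 z x) y \<oplus>\<^bsub>V\<^esub> br2 (br1 y z) x = \<zero>\<^bsub>V\<^esub>"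
      if "x \<in> carrier V" "y \<in> carrier V" "z \<in> carrier V" for x y z
      using T that unfolding totally_compatible_lie_dialgebra_def by metis
    with T show "postlie_algebra R V (\<lambda>x y. br1 (P x) y) (\<lambda>x y. br2 x y)"
      by (intro mixed_jacobi_imp_postlie P rb) (auto simp: totally_compatible_lie_dialgebra_def)
  }
qed

end
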